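(* Let $\hat p, m$ be positive integers, and for each $p=1,\ldots,\hat p$ let $n^p$ be a positive integer and let $f^p_k:\mathbb{R}^{n^p}\to\mathbb{R}$ $(0\le k\le m)$ be quadratic functions with $f^p_k(\mathbf 0)=0$. For each $k=1,\ldots,m$ let $\trianglelefteq_k$ be one of the relations $\le$, $=$, $\ge$ (the same for all $p$). Let $\gamma=(\gamma_1,\ldots,\gamma_m)\in\mathbb{R}^m$. Let $\zeta^p(\cdot)$, $\eta^p(\cdot)$, $\zeta(\gamma)$, $\eta(\gamma)$ be the optimal values, defined in the context, of the sub-QCQPs, of their SDP relaxations, of the horizontally connected QCQP, and of its SDP relaxation, respectively. Assume that (I) for each $p=1,\ldots,\hat p$ and every $\delta^p\in\mathbb{R}^m$ such that $-\infty<\eta^p(\delta^p)<\infty$, one has $\eta^p(\delta^p)=\zeta^p(\delta^p)$; and (II) the SDP relaxation defining $\eta(\gamma)$ admits an optimal solution (a feasible point attaining the infimum). Then the SDP relaxation of the horizontally connected QCQP is exact, i.e. $\eta(\gamma)=\zeta(\gamma)$.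
   Context: $\mathbb{S}^n$ is the space of real symmetric $n\times n$ matrices with inner product $\langle A,B\rangle=\sum_{i,j}A_{ij}B_{ij}$, and $\mathbb{S}^n_+$ is the cone of positive semidefinite matrices in $\mathbb{S}^n$. A quadratic function is a polynomial function of degree at most 2 (it may be identically zero). Each $f^p_k$ is represented by the matrix $B^p_k\in\mathbb{S}^{n^p+1}$ with $[B^p_k]_{n^p+1,n^p+1}=0$ such that $$f^p_k(u)=\begin{pmatrix} u \\ 1 \end{pmatrix}^T B^p_k\begin{pmatrix} u \\ 1 \end{pmatrix}=\left\langle B^p_k,\begin{pmatrix} uu^T & u \\ {u^T} & 1 \end{pmatrix}\right\rangle\quad\text{for all }u\in\mathbb{R}^{n^p}.$$ For $\delta^p=(\delta^p_1,\ldots,\delta^p_m)\in\mathbb{R}^m$, the optimal value of the $p$-th sub-QCQP is $$\zeta^p(\delta^p)=\inf\{f^p_0(u^p): u^p\in\mathbb{R}^{n^p},\ f^p_k(u^p)\trianglelefteq_k\delta^p_k\ (1\le k\le m)\},$$ and the optimal value of its SDP relaxation is $$\eta^p(\delta^p)=\inf\{\langle B^p_0,X^p\rangle: X^p\in\mathbb{S}^{n^p+1}_+,\ X^p_{n^p+1,n^p+1}=1,\ \langle B^p_k,X^p\rangle\trianglelefteq_k\delta^p_k\ (1\le k\le m)\}.$$ The optimal value of the horizontally connected QCQP is $$\zeta(\gamma)=\inf\Big\{\sum_{p=1}^{\hat p}f^p_0(u^p): u^p\in\mathbb{R}^{n^p}\ (1\le p\le\hat p),\ \sum_{p=1}^{\hat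 p}f^p_k(u^p)\trianglelefteq_k\gamma_k\ (1\le k\le m)\Big\},$$ and the optimal value of its SDP relaxation is $$\eta(\gamma)=\inf\Big\{\sum_{p=1}^{\hat p}\langle B^p_0,X^p\rangle: X^p\in\mathbb{S}^{n^p+1}_+,\ X^p_{n^p+1,n^p+1}=1\ (1\le p\le\hat p),\ \sum_{p=1}^{\hat p}\langle B^p_k,X^p\rangle\trianglelefteq_k\gamma_k\ (1\le k\le m)\Big\}.$$ All infima are taken in $[-\infty,+\infty]$, with $\inf\emptyset=+\infty$. An SDP relaxation is called exact if its optimal value equals that of the QCQP; attainment of either infimum or existence of rank-one solutions is not part of the definition. *)

theory Defs
  imports "Jordan_Normal_Form.Matrix" "HOL-Library.Extended_Real"
begin

text \<open>
  Vectors and matrices are 0-indexed, so the entry (n+1, n+1) of an (n+1) x (n+1) matrix is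
  entry (n, n) here. Indices p and k keep the ranges 1..P and 1..m (with k = 0 for the
  objective); \<open>\<delta>\<close> in R^m is a function on the naturals read only at 1..m.
\<close>

definition sym_mats :: "nat \<Rightarrow> real mat set" where
  "sym_mats n = {A \<in> carrier_mat n n. transpose_mat A = A}"

definition psd_mats :: "nat \<Rightarrow> real mat set" where
  "psd_mats n = {A \<in> sym_mats n. \<forall>v \<in> carrier_vec n. 0 \<le> v \<bullet> (A *\<^sub>v v)}"

definition mat_inner :: "real mat \<Rightarrow> real mat \<Rightarrow> real" where
  "mat_inner A B = (\<Sum>i<dim_row A. \<Sum>j<dim_col A. A $$ (i, j) * B $$ (i, j))"

definition quadratic_fun :: "nat \<Rightarrow> (real vec \<Rightarrow> real) \<Rightarrow> bool" where
  "quadratic_fun n f \<longleftrightarrow>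
     (\<exists>Q \<in> carrier_mat n n. \<exists>c \<in> carrier_vec n. \<exists>d.
        \<forall>u \<in> carrier_vec n. f u = u \<bullet> (Q *\<^sub>v u) + c \<bullet> u + d)"

definition homogenize_vec :: "real vec \<Rightarrow> real vec" where
  "homogenize_vec u = u @\<^sub>v vec 1 (\<lambda>_. 1)"

text \<open>A quadratic function vanishing at the origin is represented by exactly one matrix.\<close>

definition represents :: "nat \<Rightarrow> real mat \<Rightarrow> (real vec \<Rightarrow> real) \<Rightarrow> bool" where
  "represents n B f \<longleftrightarrow>
     B \<in> sym_mats (n + 1) \<and> B $$ (n, n) = 0 \<and>
     (\<forall>u \<in> carrier_vec n. f u = homogenize_vec u \<bullet> (B *\<^sub>v homogenize_vec u))"

text \<open>In the four optimal values below, \<open>R k\<close> is the relation of the k-th constraint. The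
  infimum over the empty set is \<open>\<infinity>\<close>.\<close>

definition sub_qcqp_val ::
  "nat \<Rightarrow> nat \<Rightarrow> (nat \<Rightarrow> real \<Rightarrow> real \<Rightarrow> bool) \<Rightarrow> (nat \<Rightarrow> real vec \<Rightarrow> real) \<Rightarrow> (nat \<Rightarrow> real) \<Rightarrow> ereal" where
  "sub_qcqp_val n m R f \<delta> =
     (INF u \<in> {u \<in> carrier_vec n. \<forall>k \<in> {1..m}. R k (f k u) (\<delta> k)}. ereal (f 0 u))"

definition sub_sdp_val ::
  "nat \<Rightarrow> nat \<Rightarrow> (nat \<Rightarrow> real \<Rightarrow> real \<Rightarrow> bool) \<Rightarrow> (nat \<Rightarrow> real mat) \<Rightarrow> (nat \<Rightarrow> real) \<Rightarrow> ereal" where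
  "sub_sdp_val n m R B \<delta> =
     (INF X \<in> {X \<in> psd_mats (n + 1). X $$ (n, n) = 1 \<and>
                (\<forall>k \<in> {1..m}. R k (mat_inner (B k) X) (\<delta> k))}. ereal (mat_inner (B 0) X))"

definition hc_qcqp_val ::
  "nat \<Rightarrow> (nat \<Rightarrow> nat) \<Rightarrow> nat \<Rightarrow> (nat \<Rightarrow> real \<Rightarrow> real \<Rightarrow> bool) \<Rightarrow>
   (nat \<Rightarrow> nat \<Rightarrow> real vec \<Rightarrow> real) \<Rightarrow> (nat \<Rightarrow> real) \<Rightarrow> ereal" where
  "hc_qcqp_val P n m R f \<gamma> =
     (INF u \<in> {u. (\<forall>p \<in> {1..P}. u p \<in> carrier_vec (n p)) \<and>
                (\<forall>k \<in> {1..m}. R k (\<Sum>p = 1..P. f p k (u p)) (\<gamma> k))}.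
        ereal (\<Sum>p = 1..P. f p 0 (u p)))"

definition hc_sdp_feasible ::
  "nat \<Rightarrow> (nat \<Rightarrow> nat) \<Rightarrow> nat \<Rightarrow> (nat \<Rightarrow> real \<Rightarrow> real \<Rightarrow> bool) \<Rightarrow>
   (nat \<Rightarrow> nat \<Rightarrow> real mat) \<Rightarrow> (nat \<Rightarrow> real) \<Rightarrow> (nat \<Rightarrow> real mat) set" where
  "hc_sdp_feasible P n m R B \<gamma> =
     {X. (\<forall>p \<in> {1..P}. X p \<in> psd_mats (n p + 1) \<and> X p $$ (n p, n p) = 1) \<and>
         (\<forall>k \<in> {1..m}. R k (\<Sum>p = 1..P. mat_inner (B p k) (X p)) (\<gamma> k))}"

definition hc_sdp_obj :: "nat \<Rightarrow> (nat \<Rightarrow> nat \<Rightarrow> real mat) \<Rightarrow> (nat \<Rightarrow> real mat) \<Rightarrow> real" where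
  "hc_sdp_obj P B X = (\<Sum>p = 1..P. mat_inner (B p 0) (X p))"

definition hc_sdp_val ::
  "nat \<Rightarrow> (nat \<Rightarrow> nat) \<Rightarrow> nat \<Rightarrow> (nat \<Rightarrow> real \<Rightarrow> real \<Rightarrow> bool) \<Rightarrow>
   (nat \<Rightarrow> nat \<Rightarrow> real mat) \<Rightarrow> (nat \<Rightarrow> real) \<Rightarrow> ereal" where
  "hc_sdp_val P n m R B \<gamma> = (INF X \<in> hc_sdp_feasible P n m R B \<gamma>. ereal (hc_sdp_obj P B X))"

end

theory Submission
  imports Defs
begin

text \<open>
  Let X be an optimal SDP solution and let \<open>\<delta>\<^sub>p\<close> consist of the values at X p of the p-th summands
  of the constraints. Replacing X p by any point feasible for the p-th sub-SDP with right-hand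
  side \<open>\<delta>\<^sub>p\<close> keeps X feasible, since each relation is translation invariant and transitive;
  hence X p is optimal for that sub-SDP, whose value is therefore finite. By (I) each sub-QCQP
  has points nearly attaining this value, and together they are feasible for the connected QCQP.
\<close>

definition outer_prod :: "real vec \<Rightarrow> real mat" where
  "outer_prod h = mat (dim_vec h) (dim_vec h) (\<lambda>(i, j). h $ i * h $ j)"

lemma outer_prod_carrier [simp]: "outer_prod h \<in> carrier_mat (dim_vec h) (dim_vec h)"
  by (simp add: outer_prod_def)

lemma outer_prod_mult_vec:
  assumes "v \<in> carrier_vec (dim_vec h)"
  shows "outer_prod h *\<^sub>v v = (h \<bullet> v) \<cdot>\<^sub>v h"
  using assms
  by (intro eq_vecI)
    (auto simp: outer_prod_def scalar_prod_def sum_distrib_left sum_distrib_right mult_ac intro!: sum.cong)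

text \<open>The quadratic form at \<open>v\<close> is the square of
  \<open>h \<bullet> v\<close>.\<close>

lemma outer_prod_psd: "outer_prod h \<in> psd_mats (dim_vec h)"
proof -
  have "transpose_mat (outer_prod h) = outer_prod h"
    by (rule eq_matI) (auto simp: outer_prod_def mult.commute)
  moreover have "0 \<le> v \<bullet> (outer_prod h *\<^sub>v v)" if "v \<in> carrier_vec (dim_vec h)" for v
  proof -
    have "v \<bullet> (outer_prod h *\<^sub>v v) = (h \<bullet> v) * (v \<bullet> h)"
      using that by (simp add: outer_prod_mult_vec scalar_prod_smult_right)
    also have "v \<bullet> h = h \<bullet> v"
      using that by (intro comm_scalar_prod[of _ "dim_vec h"]) auto
    finally show ?thesis by simp
  qed
  ultimately show ?thesis
    by (simp add: psd_mats_def sym_mats_def)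
qed

lemma mat_inner_outer_prod:
  assumes "A \<in> carrier_mat (dim_vec h) (dim_vec h)"
  shows "mat_inner A (outer_prod h) = h \<bullet> (A *\<^sub>v h)"
  using assms
  by (auto simp: mat_inner_def outer_prod_def scalar_prod_def sum_distrib_left mult_ac atLeast0LessThan
      intro!: sum.cong)

text \<open>The rank-one lift turns a point of a sub-QCQP into a point of its SDP relaxation at
  which every represented function keeps its value.\<close>

lemma homogenize_lift:
  assumes "u \<in> carrier_vec n"
  shows "outer_prod (homogenize_vec u) \<in> psd_mats (n + 1)"
    and "outer_prod (homogenize_vec u) $$ (n, n) = 1"
    and "represents n A g \<Longrightarrow> mat_inner A (outer_prod (homogenize_vec u)) = g u"
proof -
  have dim: "dim_vec (homogenize_vec u) = n + 1"
    using assms by (simp add: homogenize_vec_def)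
  show "outer_prod (homogenize_vec u) \<in> psd_mats (n + 1)"
    using outer_prod_psd[of "homogenize_vec u"] dim by simp
  show "outer_prod (homogenize_vec u) $$ (n, n) = 1"
    \<comment> \<open>The fact \<open>dim\<close> concerns the folded
      \<open>homogenize_vec u\<close>, so it is used before unfolding reveals that the last
      coordinate is 1.\<close>
    using assms dim by (simp add: outer_prod_def) (simp add: homogenize_vec_def)
  show "mat_inner A (outer_prod (homogenize_vec u)) = g u" if "represents n A g"
    using that assms dim by (simp add: represents_def sym_mats_def mat_inner_outer_prod)
qed

text \<open>Lifting every block separately embeds the QCQP in its relaxation, preserving the
  constraint sums and the objective.\<close>

lemma hc_sdp_val_le_hc_qcqp_val:
  assumes "\<And>p k. p \<in> {1..P} \<Longrightarrow> k \<in> {0..m} \<Longrightarrow> represents (n p) (B p k) (f p k)"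
  shows "hc_sdp_val P n m R B \<gamma> \<le> hc_qcqp_val P n m R f \<gamma>"
  unfolding hc_qcqp_val_def
proof (rule INF_greatest)
  fix u
  assume u: "u \<in> {u. (\<forall>p \<in> {1..P}. u p \<in> carrier_vec (n p)) \<and>
      (\<forall>k \<in> {1..m}. R k (\<Sum>p = 1..P. f p k (u p)) (\<gamma> k))}"
  define X where "X p = outer_prod (homogenize_vec (u p))" for p
  have val: "(\<Sum>p = 1..P. mat_inner (B p k) (X p)) = (\<Sum>p = 1..P. f p k (u p))"
    if "k \<in> {0..m}" for k
    using that u assms unfolding X_def by (intro sum.cong refl homogenize_lift(3)) auto
  have "X \<in> hc_sdp_feasible P n m R B \<gamma>"
    using u val homogenize_lift(1,2) by (auto simp: hc_sdp_feasible_def X_def)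
  moreover have "hc_sdp_obj P B X = (\<Sum>p = 1..P. f p 0 (u p))"
    using val[of 0] by (simp add: hc_sdp_obj_def)
  ultimately show "hc_sdp_val P n m R B \<gamma> \<le> ereal (\<Sum>p = 1..P. f p 0 (u p))"
    unfolding hc_sdp_val_def by (metis INF_lower)
qed

text \<open>Each of the three relations is a preorder compatible with addition. Later arguments
  reach them only through these facts, which avoids a case split.\<close>

lemma
  fixes r :: "real \<Rightarrow> real \<Rightarrow> bool"
  assumes "r \<in> {(\<le>), (=), (\<ge>)}"
  shows constraint_relation_refl: "r a a"
    and constraint_relation_trans: "r a b \<Longrightarrow> r b c \<Longrightarrow> r a c"
    and constraint_relation_sum: "(\<And>i. i \<in> I \<Longrightarrow> r (g i) (h i)) \<Longrightarrow> r (sum g I) (sum h I)"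
  using assms by (auto intro: sum_mono)

lemma hc_sdp_optimal_component:
  assumes rel: "\<And>k. k \<in> {1..m} \<Longrightarrow> R k \<in> {(\<le>), (=), (\<ge>)}"
    and X: "X \<in> hc_sdp_feasible P n m R B \<gamma>"
    and opt: "ereal (hc_sdp_obj P B X) = hc_sdp_val P n m R B \<gamma>"
    and p: "p \<in> {1..P}"
  shows "sub_sdp_val (n p) m R (B p) (\<lambda>k. mat_inner (B p k) (X p)) = ereal (mat_inner (B p 0) (X p))"
  unfolding sub_sdp_val_def
proof (intro antisym INF_lower INF_greatest)
  show "X p \<in> {Y \<in> psd_mats (n p + 1). Y $$ (n p, n p) = 1 \<and>
      (\<forall>k\<in>{1..m}. R k (mat_inner (B p k) Y) (mat_inner (B p k) (X p)))}"
    using X p constraint_relation_refl[OF rel] by (auto simp: hc_sdp_feasible_def)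
next
  fix Y
  assume Y: "Y \<in> {Y \<in> psd_mats (n p + 1). Y $$ (n p, n p) = 1 \<and>
      (\<forall>k\<in>{1..m}. R k (mat_inner (B p k) Y) (mat_inner (B p k) (X p)))}"
  \<comment> \<open>Blocks interact only through sums, so exchanging one of them leaves all other
    summands unchanged.\<close>
  let ?X = "X(p := Y)"
  have "R k (\<Sum>q = 1..P. mat_inner (B q k) (?X q)) (\<gamma> k)" if k: "k \<in> {1..m}" for k
  proof (rule constraint_relation_trans[OF rel[OF k]])
    show "R k (\<Sum>q = 1..P. mat_inner (B q k) (?X q)) (\<Sum>q = 1..P. mat_inner (B q k) (X q))"
      using Y k constraint_relation_refl[OF rel[OF k]]
      by (intro constraint_relation_sum[OF rel[OF k]]) auto
    show "R k (\<Sum>q = 1..P. mat_inner (B q k) (X q)) (\<gamma> k)"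
      using X k by (auto simp: hc_sdp_feasible_def)
  qed
  then have "?X \<in> hc_sdp_feasible P n m R B \<gamma>"
    using X Y by (auto simp: hc_sdp_feasible_def)
  then have "ereal (hc_sdp_obj P B X) \<le> ereal (hc_sdp_obj P B ?X)"
    unfolding opt hc_sdp_val_def by (rule INF_lower)
  then have "(\<Sum>q = 1..P. mat_inner (B q 0) (X q)) \<le> (\<Sum>q = 1..P. mat_inner (B q 0) (?X q))"
    by (simp add: hc_sdp_obj_def)
  \<comment> \<open>The comparison has been moved from \<open>ereal\<close> to the reals, so these
    common summands cancel and only block \<open>p\<close> is left.\<close>
  moreover have "(\<Sum>q \<in> {1..P} - {p}. mat_inner (B q 0) (?X q)) =
      (\<Sum>q \<in> {1..P} - {p}. mat_inner (B q 0) (X q))"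
    by (intro sum.cong) auto
  ultimately show "ereal (mat_inner (B p 0) (X p)) \<le> ereal (mat_inner (B p 0) Y)"
    using p by (simp add: sum.remove[of _ p])
qed

text \<open>Here \<open>\<delta>\<close> splits the right-hand side \<open>\<gamma>\<close> among
  the blocks. The sub-QCQP infima need not be attained, so nearly optimal points are combined with a
  total error of at most \<open>e\<close>.\<close>

lemma hc_qcqp_val_le_sum:
  assumes rel: "\<And>k. k \<in> {1..m} \<Longrightarrow> R k \<in> {(\<le>), (=), (\<ge>)}"
    and \<delta>: "\<And>k. k \<in> {1..m} \<Longrightarrow> R k (\<Sum>p = 1..P. \<delta> p k) (\<gamma> k)"
    and val: "\<And>p. p \<in> {1..P} \<Longrightarrow> sub_qcqp_val (n p) m R (f p) (\<delta> p) = ereal (v p)"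
  shows "hc_qcqp_val P n m R f \<gamma> \<le> ereal (\<Sum>p = 1..P. v p)"
proof (rule ereal_le_epsilon2)
  fix e :: real
  assume e: "0 < e"
  \<comment> \<open>Each of the \<open>P\<close> blocks may lose \<open>d\<close>; the added 1 keeps
    the denominator positive even if \<open>P = 0\<close>.\<close>
  define d where "d = e / (real P + 1)"
  have d: "0 < d"
    using e by (simp add: d_def)
  have "\<forall>p\<in>{1..P}. \<exists>u. u \<in> carrier_vec (n p) \<and>
      (\<forall>k\<in>{1..m}. R k (f p k u) (\<delta> p k)) \<and> f p 0 u < v p + d"
  proof
    fix p
    assume "p \<in> {1..P}"
    \<comment> \<open>As the infimum is finite, adding \<open>d\<close> exceeds it strictly, which
      forces a feasible point below the new bound.\<close>
    then have "sub_qcqp_val (n p) m R (f p) (\<delta> p) < ereal (v p + d)"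
      using val d by simp
    then show "\<exists>u. u \<in> carrier_vec (n p) \<and>
        (\<forall>k\<in>{1..m}. R k (f p k u) (\<delta> p k)) \<and> f p 0 u < v p + d"
      by (auto simp: sub_qcqp_val_def INF_less_iff)
  qed
  then obtain u where u: "\<And>p. p \<in> {1..P} \<Longrightarrow> u p \<in> carrier_vec (n p) \<and>
      (\<forall>k\<in>{1..m}. R k (f p k (u p)) (\<delta> p k)) \<and> f p 0 (u p) < v p + d"
    by metis
  have "R k (\<Sum>p = 1..P. f p k (u p)) (\<gamma> k)" if k: "k \<in> {1..m}" for k
  proof (rule constraint_relation_trans[OF rel[OF k] _ \<delta>[OF k]])
    show "R k (\<Sum>p = 1..P. f p k (u p)) (\<Sum>p = 1..P. \<delta> p k)"
      using u k by (intro constraint_relation_sum[OF rel[OF k]]) blast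
  qed
  then have le: "hc_qcqp_val P n m R f \<gamma> \<le> ereal (\<Sum>p = 1..P. f p 0 (u p))"
    unfolding hc_qcqp_val_def using u by (intro INF_lower) auto
  have "(\<Sum>p = 1..P. f p 0 (u p)) \<le> (\<Sum>p = 1..P. v p + d)"
    using u by (intro sum_mono less_imp_le) blast
  moreover have "(\<Sum>p = 1..P. v p + d) = (\<Sum>p = 1..P. v p) + real P * d"
    by (simp add: sum.distrib)
  moreover have "real P * d \<le> e"
    using e by (simp add: d_def field_simps)
  ultimately have "(\<Sum>p = 1..P. f p 0 (u p)) \<le> (\<Sum>p = 1..P. v p) + e"
    by linarith
  with le show "hc_qcqp_val P n m R f \<gamma> \<le> ereal (\<Sum>p = 1..P. v p) + ereal e"
    by (metis ereal_less_eq(3) order_trans plus_ereal.simps(1))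
qed

theorem theorem1p1:
  fixes P m :: nat
    and n :: "nat \<Rightarrow> nat"
    and f :: "nat \<Rightarrow> nat \<Rightarrow> real vec \<Rightarrow> real"
    and B :: "nat \<Rightarrow> nat \<Rightarrow> real mat"
    and R :: "nat \<Rightarrow> real \<Rightarrow> real \<Rightarrow> bool"
    and \<gamma> :: "nat \<Rightarrow> real"
  assumes "P \<ge> 1" and "m \<ge> 1"
    and "\<And>p. p \<in> {1..P} \<Longrightarrow> n p \<ge> 1"
    and "\<And>p k. p \<in> {1..P} \<Longrightarrow> k \<in> {0..m} \<Longrightarrow> quadratic_fun (n p) (f p k)"
    and "\<And>p k. p \<in> {1..P} \<Longrightarrow> k \<in> {0..m} \<Longrightarrow> f p k (0\<^sub>v (n p)) = 0"
    and "\<And>p k. p \<in> {1..P} \<Longrightarrow> k \<in> {0..m} \<Longrightarrow> represents (n p) (B p k) (f p k)"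
    and "\<And>k. k \<in> {1..m} \<Longrightarrow> R k \<in> {(\<le>), (=), (\<ge>)}"
    and I: "\<And>p \<delta>. p \<in> {1..P} \<Longrightarrow>
        -\<infinity> < sub_sdp_val (n p) m R (B p) \<delta> \<Longrightarrow> sub_sdp_val (n p) m R (B p) \<delta> < \<infinity> \<Longrightarrow>
        sub_sdp_val (n p) m R (B p) \<delta> = sub_qcqp_val (n p) m R (f p) \<delta>"
    and II: "\<exists>X \<in> hc_sdp_feasible P n m R B \<gamma>.
        ereal (hc_sdp_obj P B X) = hc_sdp_val P n m R B \<gamma>"
  shows "hc_sdp_val P n m R B \<gamma> = hc_qcqp_val P n m R f \<gamma>"
proof (rule antisym)
  show "hc_sdp_val P n m R B \<gamma> \<le> hc_qcqp_val P n m R f \<gamma>"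
    using assms(6) by (rule hc_sdp_val_le_hc_qcqp_val)
  obtain X where X: "X \<in> hc_sdp_feasible P n m R B \<gamma>"
    and opt: "ereal (hc_sdp_obj P B X) = hc_sdp_val P n m R B \<gamma>"
    using II by blast
  have "sub_qcqp_val (n p) m R (f p) (\<lambda>k. mat_inner (B p k) (X p)) = ereal (mat_inner (B p 0) (X p))"
    if p: "p \<in> {1..P}" for p
    \<comment> \<open>The sub-SDP value is \<open>ereal\<close> of a real number, which settles both
      finiteness premises of \<open>I\<close>.\<close>
    using I[OF p] hc_sdp_optimal_component[OF assms(7) X opt p] by simp
  then have "hc_qcqp_val P n m R f \<gamma> \<le> ereal (\<Sum>p = 1..P. mat_inner (B p 0) (X p))"
    \<comment> \<open>For this choice of \<open>\<delta>\<close>, the condition on its sums is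
      exactly that \<open>X\<close> satisfies the connected constraints.\<close>
    using X by (intro hc_qcqp_val_le_sum[OF assms(7)]) (auto simp: hc_sdp_feasible_def)
  then show "hc_qcqp_val P n m R f \<gamma> \<le> hc_sdp_val P n m R B \<gamma>"
    by (simp flip: opt add: hc_sdp_obj_def)
qed

end
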